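(* Let $Q^T\tau$ be a system of $s$ pairwise comparisons of $v$ treatments, with coefficient matrix $Q$ of rank $r$, let $w$ be a feasible treatment design for $Q^T\tau$, and let $\Phi$ be an orthogonally invariant information function on $s\times s$ non-negative definite matrices, written as $\Phi(H)=\phi(\lambda_1(H),\ldots,\lambda_s(H))$. Let $\mathcal{L}_w$ be the vertex-weighted Laplacian, with vertex weights $\alpha_i=w_i^{-1}$, of the graph corresponding to $Q^T\tau$. Then, if $Q^T\tau$ is a full-rank system, $$\Phi(w)=\phi\big(1/\lambda_s(\mathcal{L}_w),\ldots,1/\lambda_1(\mathcal{L}_w)\big),$$ and if $Q^T\tau$ is rank deficient, $$\Phi(w)=\phi\big(1/\lambda_r(\mathcal{L}_w),\ldots,1/\lambda_1(\mathcal{L}_w),0,\ldots,0\big).$$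
   Context: Eigenvalues of a symmetric matrix $A$ are ordered $\lambda_1(A)\ge\lambda_2(A)\ge\ldots$. Systems and designs: $\tau=(\tau_1,\ldots,\tau_v)^T$ are treatment effects. A system of $s$ contrasts $Q^T\tau$ is given by a real $v\times s$ matrix $Q$ with $Q^T1_v=0_s$; $r=\mathrm{rank}(Q)$; no row of $Q$ is zero. It is full-rank if $s\le v$ and $r=s$, otherwise rank deficient. A (treatment) design is $w=(w_1,\ldots,w_v)^T$ with $w_i\in[0,1]$, $\sum_i w_i=1$; it is feasible if and only if $w_i>0$ for all $i$. $M(w)=\mathrm{diag}(w_1,\ldots,w_v)$. For feasible $w$, $N_Q(w)=(Q^TM^{-1}(w)Q)^{-1}$ in the full-rank case and $C_Q(w)=(Q^TM^{-1}(w)Q)^+$ (Moore-Penrose pseudoinverse) in the rank deficient case. $\Phi(w)$ stands for $\Phi(N_Q(w))$ (full-rank case) or $\Phi(C_Q(w))$ (rank deficient case). Pairwise comparisons and graph: $Q^T\tau$ is a system of pairwise comparisons if every column of $Q$ represents a difference $\tau_j-\tau_i$ with $i\neq j$ (entry $1$ in row $j$, $-1$ in row $i$, zeros elsewhere), different columns corresponding to different unordered pairs $\{i,j\}$. The corresponding directed graph has vertex set $\{1,\ldots,v\}$ and an edge $(j,i)$ for each comparison $\tau_j-\tau_i$ in the system; its incidence matrix is $Q$. The vertex-weighted Laplacian with vertex weights $\alpha_i=w_i^{-1}$ is $\mathcal{L}_w=M^{-1/2}(w)QQ^TM^{-1/2}(w)$. Criteria: an information function $\Phi$ is a real function on $s\times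 s$ non-negative definite matrices that is positively homogeneous, superadditive, Loewner isotonic, concave and upper semicontinuous. It is orthogonally invariant if $\Phi(UHU^T)=\Phi(H)$ for every orthogonal $U$, i.e. if it depends only on the eigenvalues of $H$; $\phi$ denotes the corresponding function of the (decreasingly ordered) eigenvalues. *)

theory Defs
  imports
    "Jordan_Normal_Form.Matrix"
    "Jordan_Normal_Form.Char_Poly"
    "Jordan_Normal_Form.Gauss_Jordan_Elimination"
    "Jordan_Normal_Form.DL_Rank"
    "Graph_Theory.Digraph"
    "HOL-Computational_Algebra.Computational_Algebra"
begin

(* Treatments, matrix indices and vertices are numbered from 0, eigenvalues from 1. *)

section \<open>Real matrices\<close>

(* The real eigenvalues, repeated according to algebraic multiplicity, in decreasing order.
   For a symmetric matrix these are all eigenvalues. *)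
definition eigvals_desc :: "real mat \<Rightarrow> real list" where
  "eigvals_desc A = rev (sorted_list_of_multiset (proots (char_poly A)))"

definition eigval :: "real mat \<Rightarrow> nat \<Rightarrow> real" where
  "eigval A k = eigvals_desc A ! (k - 1)"

definition inverse_mat :: "real mat \<Rightarrow> real mat" where
  "inverse_mat A = the (mat_inverse A)"

definition is_pseudoinverse :: "real mat \<Rightarrow> real mat \<Rightarrow> bool" where
  "is_pseudoinverse A X \<longleftrightarrow>
     X \<in> carrier_mat (dim_col A) (dim_row A) \<and>
     A * X * A = A \<and> X * A * X = X \<and>
     transpose_mat (A * X) = A * X \<and> transpose_mat (X * A) = X * A"

definition pseudoinverse :: "real mat \<Rightarrow> real mat" where
  "pseudoinverse A = (THE X. is_pseudoinverse A X)"

definition nnd_mats :: "nat \<Rightarrow> real mat set" where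
  "nnd_mats n = {A \<in> carrier_mat n n. transpose_mat A = A \<and>
     (\<forall>x \<in> carrier_vec n. 0 \<le> x \<bullet> (A *\<^sub>v x))}"

definition loewner_le :: "nat \<Rightarrow> real mat \<Rightarrow> real mat \<Rightarrow> bool" where
  "loewner_le n A B \<longleftrightarrow> B - A \<in> nnd_mats n"

(* The library's orthogonal_mat does not require normalized columns. *)
definition orthonormal_mats :: "nat \<Rightarrow> real mat set" where
  "orthonormal_mats n = {U \<in> carrier_mat n n.
     U * transpose_mat U = 1\<^sub>m n \<and> transpose_mat U * U = 1\<^sub>m n}"


section \<open>Optimality criteria\<close>

(* Real matrices carry no topology in the library; upper semicontinuity is spelled out
   for the entrywise maximum norm. *)
definition usc_on_nnd :: "nat \<Rightarrow> (real mat \<Rightarrow> real) \<Rightarrow> bool" where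
  "usc_on_nnd n \<Phi> \<longleftrightarrow>
     (\<forall>H \<in> nnd_mats n. \<forall>c > \<Phi> H. \<exists>\<delta> > 0. \<forall>K \<in> nnd_mats n.
        (\<forall>i < n. \<forall>j < n. \<bar>K $$ (i, j) - H $$ (i, j)\<bar> < \<delta>) \<longrightarrow> \<Phi> K < c)"

definition information_function :: "nat \<Rightarrow> (real mat \<Rightarrow> real) \<Rightarrow> bool" where
  "information_function n \<Phi> \<longleftrightarrow>
     (\<forall>H \<in> nnd_mats n. \<forall>a > 0. \<Phi> (a \<cdot>\<^sub>m H) = a * \<Phi> H) \<and>
     (\<forall>H \<in> nnd_mats n. \<forall>K \<in> nnd_mats n. \<Phi> H + \<Phi> K \<le> \<Phi> (H + K)) \<and>
     (\<forall>H \<in> nnd_mats n. \<forall>K \<in> nnd_mats n. loewner_le n H K \<longrightarrow> \<Phi> H \<le> \<Phi> K) \<and>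
     (\<forall>H \<in> nnd_mats n. \<forall>K \<in> nnd_mats n. \<forall>t. 0 \<le> t \<and> t \<le> 1 \<longrightarrow>
        t * \<Phi> H + (1 - t) * \<Phi> K \<le> \<Phi> (t \<cdot>\<^sub>m H + (1 - t) \<cdot>\<^sub>m K)) \<and>
     usc_on_nnd n \<Phi>"

definition orthogonally_invariant :: "nat \<Rightarrow> (real mat \<Rightarrow> real) \<Rightarrow> bool" where
  "orthogonally_invariant n \<Phi> \<longleftrightarrow>
     (\<forall>H \<in> nnd_mats n. \<forall>U \<in> orthonormal_mats n. \<Phi> (U * H * transpose_mat U) = \<Phi> H)"


section \<open>Systems of contrasts and designs\<close>

definition contrast_system :: "nat \<Rightarrow> nat \<Rightarrow> real mat \<Rightarrow> bool" where
  "contrast_system v s Q \<longleftrightarrow>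
     Q \<in> carrier_mat v s \<and>
     transpose_mat Q *\<^sub>v vec v (\<lambda>_. 1) = 0\<^sub>v s \<and>
     (\<forall>i < v. row Q i \<noteq> 0\<^sub>v s)"

abbreviation mat_rank :: "real mat \<Rightarrow> nat" where
  "mat_rank A \<equiv> vec_space.rank (dim_row A) A"

definition full_rank_system :: "real mat \<Rightarrow> bool" where
  "full_rank_system Q \<longleftrightarrow> dim_col Q \<le> dim_row Q \<and> mat_rank Q = dim_col Q"

definition design :: "nat \<Rightarrow> real vec \<Rightarrow> bool" where
  "design v w \<longleftrightarrow> w \<in> carrier_vec v \<and>
     (\<forall>i < v. 0 \<le> w $ i \<and> w $ i \<le> 1) \<and> (\<Sum>i < v. w $ i) = 1"

definition feasible_design :: "nat \<Rightarrow> real vec \<Rightarrow> bool" where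
  "feasible_design v w \<longleftrightarrow> design v w \<and> (\<forall>i < v. 0 < w $ i)"

definition moment_mat :: "real vec \<Rightarrow> real mat" where
  "moment_mat w = mat_diag (dim_vec w) (\<lambda>i. w $ i)"

definition information_mat :: "real mat \<Rightarrow> real vec \<Rightarrow> real mat" where
  "information_mat Q w =
     inverse_mat (transpose_mat Q * inverse_mat (moment_mat w) * Q)"

definition generalized_information_mat :: "real mat \<Rightarrow> real vec \<Rightarrow> real mat" where
  "generalized_information_mat Q w =
     pseudoinverse (transpose_mat Q * inverse_mat (moment_mat w) * Q)"

definition criterion_value :: "(real mat \<Rightarrow> real) \<Rightarrow> real mat \<Rightarrow> real vec \<Rightarrow> real" where
  "criterion_value \<Phi> Q w =
     (if full_rank_system Q then \<Phi> (information_mat Q w)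
      else \<Phi> (generalized_information_mat Q w))"


section \<open>Pairwise comparisons and their graph\<close>

(* Column e of Q represents the comparison of treatment j with treatment i (j minus i). *)
definition comparison_column :: "real mat \<Rightarrow> nat \<Rightarrow> nat \<Rightarrow> nat \<Rightarrow> bool" where
  "comparison_column Q e j i \<longleftrightarrow>
     j < dim_row Q \<and> i < dim_row Q \<and> i \<noteq> j \<and>
     (\<forall>k < dim_row Q. Q $$ (k, e) = (if k = j then 1 else if k = i then -1 else 0))"

definition pairwise_comparison_system :: "nat \<Rightarrow> nat \<Rightarrow> real mat \<Rightarrow> bool" where
  "pairwise_comparison_system v s Q \<longleftrightarrow>
     contrast_system v s Q \<and>
     (\<forall>e < s. \<exists>j i. comparison_column Q e j i) \<and>
     (\<forall>e < s. \<forall>f < s. \<forall>j i j' i'. e \<noteq> f \<longrightarrow>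
        comparison_column Q e j i \<longrightarrow> comparison_column Q f j' i' \<longrightarrow> {j, i} \<noteq> {j', i'})"

(* Arcs are named by the columns of Q; arc e is the directed edge (j, i)
   for the comparison in column e. *)
definition comparison_graph :: "real mat \<Rightarrow> (nat, nat) pre_digraph" where
  "comparison_graph Q =
     \<lparr> verts = {..< dim_row Q}, arcs = {..< dim_col Q},
       tail = (\<lambda>e. THE j. \<exists>i. comparison_column Q e j i),
       head = (\<lambda>e. THE i. \<exists>j. comparison_column Q e j i) \<rparr>"

(* For digraphs whose vertices and arcs are initial segments of the natural numbers. *)
definition incidence_mat :: "(nat, nat) pre_digraph \<Rightarrow> real mat" where
  "incidence_mat G = mat (card (verts G)) (card (arcs G))
     (\<lambda>(k, e). if k = tail G e then 1 else if k = head G e then -1 else 0)"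

definition weighted_laplacian :: "(nat, nat) pre_digraph \<Rightarrow> (nat \<Rightarrow> real) \<Rightarrow> real mat" where
  "weighted_laplacian G \<alpha> =
     (let D = mat_diag (card (verts G)) (\<lambda>i. sqrt (\<alpha> i)); B = incidence_mat G
      in D * B * transpose_mat B * D)"

lemma comparison_column_unique:
  assumes "comparison_column Q e j i" "comparison_column Q e j' i'"
  shows "j' = j" "i' = i"
proof -
  have "Q $$ (j', e) = 1" "Q $$ (i', e) = -1"
    and "j' < dim_row Q" "i' < dim_row Q"
    using assms(2) by (auto simp: comparison_column_def)
  with assms(1) show "j' = j" "i' = i"
    by (auto simp: comparison_column_def split: if_splits)
qed

lemma comparison_graph_tail_head:
  assumes "comparison_column Q e j i"
  shows "tail (comparison_graph Q) e = j" "head (comparison_graph Q) e = i"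
  unfolding comparison_graph_def pre_digraph.simps
  using assms comparison_column_unique[OF assms] by (blast intro: the_equality)+

lemma incidence_mat_comparison_graph:
  assumes "pairwise_comparison_system v s Q"
  shows "incidence_mat (comparison_graph Q) = Q"
proof (rule eq_matI)
  fix k e assume ke: "k < dim_row Q" "e < dim_col Q"
  with assms obtain j i where ji: "comparison_column Q e j i"
    by (auto simp: pairwise_comparison_system_def contrast_system_def)
  have "incidence_mat (comparison_graph Q) $$ (k, e) =
      (if k = j then 1 else if k = i then -1 else 0)"
    using ke comparison_graph_tail_head[OF ji]
    by (simp add: incidence_mat_def comparison_graph_def)
  also have "\<dots> = Q $$ (k, e)"
    using ke ji by (simp add: comparison_column_def)
  finally show "incidence_mat (comparison_graph Q) $$ (k, e) = Q $$ (k, e)" .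
qed (simp_all add: incidence_mat_def comparison_graph_def)

end

(* Put B = M^{-1/2} Q. The Laplacian is B B^T, whereas the matrix Q^T M^{-1} Q to be (pseudo)inverted
   is B^T B. The two have the same nonzero eigenvalues with multiplicity; all eigenvalues are
   nonnegative, and exactly rank Q of them are nonzero. By the spectral theorem B^T B = U diag(d) U^T
   with U orthogonal, so its pseudoinverse is U diag(1/d) U^T with 1/0 read as 0, which is the
   ordinary inverse if no d_i vanishes. *)
theory Submission
  imports Defs "Jordan_Normal_Form.Schur_Decomposition"
begin

text \<open>\<open>eigvals_desc\<close> is read off the roots of the characteristic polynomial, so
  the nonzero eigenvalues of B B^T and B^T B have to agree as multisets; transporting single
  eigenvectors would not give this, comparing characteristic polynomials of similar block matrices
  does. Counting them needs an argument of its own, because r is the rank of Q and not of B. If B^T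
  B = U diag(d) U^T, the columns of Q U are orthogonal for the inner product with weights 1/w_i and
  have squared lengths d_i. The nonzero ones form a maximal independent set of columns, and right
  multiplication by U keeps the column space of Q. The outcome is one multiset P of r positive
  numbers: B^T B has P and s - r zeros, the Laplacian has P and v - r zeros. Reciprocals reverse the
  order on P and leave the zeros last, whence the reversed index list followed by zeros. In the
  full-rank case s = r, so a single formula covers both claims.\<close>

no_notation fps_nth (infixl \<open>$\<close> 75)

section \<open>The spectral theorem for real symmetric matrices\<close>

lemma scalar_prod_symmetric_mat:
  fixes A :: "'a::comm_semiring_0 mat"
  assumes "A \<in> carrier_mat n n" "transpose_mat A = A" "x \<in> carrier_vec n" "y \<in> carrier_vec n"
  shows "x \<bullet> (A *\<^sub>v y) = y \<bullet> (A *\<^sub>v x)"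
proof -
  have "x \<bullet> (A *\<^sub>v y) = (transpose_mat A *\<^sub>v x) \<bullet> y"
    by (rule transpose_vec_mult_scalar[symmetric]) (use assms in auto)
  also have "\<dots> = y \<bullet> (A *\<^sub>v x)"
    using assms by (simp add: comm_scalar_prod[of _ n])
  finally show ?thesis .
qed

text \<open>A complex eigenpair (z, u) exists by the fundamental theorem of algebra. Split u = x + i
  y. Symmetry of A forces z to be real, and then x and y both satisfy the real eigenvalue equation;
  at least one of them is nonzero.\<close>

lemma symmetric_mat_real_eigenvector:
  fixes A :: "real mat"
  assumes A: "A \<in> carrier_mat n n" "transpose_mat A = A" and n: "n > 0"
  shows "\<exists>v e. eigenvector A v e"
proof -
  let ?C = "map_mat complex_of_real A"
  have C: "?C \<in> carrier_mat n n" using A by simp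
  have "degree (char_poly ?C) = n" using degree_monic_char_poly[OF C] by simp
  then have "\<not> constant (poly (char_poly ?C))" using n by (simp add: constant_degree)
  then obtain z where "poly (char_poly ?C) z = 0"
    using fundamental_theorem_of_algebra by blast
  then obtain u where u: "u \<in> carrier_vec n" "u \<noteq> 0\<^sub>v n" "?C *\<^sub>v u = z \<cdot>\<^sub>v u"
    using eigenvalue_root_char_poly[OF C] C unfolding eigenvalue_def eigenvector_def by auto
  define x y where "x = map_vec Re u" and "y = map_vec Im u"
  have xy: "x \<in> carrier_vec n" "y \<in> carrier_vec n" using u(1) by (auto simp: x_def y_def)
  have comp: "(\<Sum>j<n. of_real (A $$ (i, j)) * u $ j) = z * u $ i" if "i < n" for i
    using arg_cong[OF u(3), of "\<lambda>v. v $ i"] that A u(1)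
    by (simp add: scalar_prod_def atLeast0LessThan)
  have Ax: "A *\<^sub>v x = Re z \<cdot>\<^sub>v x - Im z \<cdot>\<^sub>v y"
  proof (rule eq_vecI)
    fix i assume "i < dim_vec (Re z \<cdot>\<^sub>v x - Im z \<cdot>\<^sub>v y)"
    then have i: "i < n" using xy by simp
    show "(A *\<^sub>v x) $ i = (Re z \<cdot>\<^sub>v x - Im z \<cdot>\<^sub>v y) $ i"
      using arg_cong[OF comp[OF i], of Re] i A u(1)
      by (simp add: scalar_prod_def atLeast0LessThan x_def y_def)
  qed (use A xy in auto)
  have Ay: "A *\<^sub>v y = Re z \<cdot>\<^sub>v y + Im z \<cdot>\<^sub>v x"
  proof (rule eq_vecI)
    fix i assume "i < dim_vec (Re z \<cdot>\<^sub>v y + Im z \<cdot>\<^sub>v x)"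
    then have i: "i < n" using xy by simp
    show "(A *\<^sub>v y) $ i = (Re z \<cdot>\<^sub>v y + Im z \<cdot>\<^sub>v x) $ i"
      using arg_cong[OF comp[OF i], of Im] i A u(1)
      by (simp add: scalar_prod_def atLeast0LessThan x_def y_def)
  qed (use A xy in auto)
  have "x \<bullet> x + y \<bullet> y > 0"
  proof -
    obtain i where i: "i < n" "u $ i \<noteq> 0" using u(1,2) by (metis carrier_vecD eq_vecI index_zero_vec)
    have "x \<bullet> x + y \<bullet> y = (\<Sum>j<n. (x $ j)^2 + (y $ j)^2)"
      using xy by (simp add: scalar_prod_def atLeast0LessThan power2_eq_square sum.distrib)
    also have "\<dots> \<ge> (x $ i)^2 + (y $ i)^2"
      by (rule member_le_sum[of i]) (use i in auto)
    finally show ?thesis using i u(1)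
      by (auto simp: x_def y_def complex_eq_iff sum_power2_gt_zero_iff intro: less_le_trans[rotated])
  qed
  moreover have "y \<bullet> (A *\<^sub>v x) = x \<bullet> (A *\<^sub>v y)"
    by (rule scalar_prod_symmetric_mat[OF A]) (use xy in auto)
  \<comment> \<open>The two sides expand to Re z (x . y) - Im z (y . y) and Re z (x . y) + Im z (x .
    x).\<close>
  then have "Im z * (x \<bullet> x + y \<bullet> y) = 0"
    using xy by (simp add: Ax Ay scalar_prod_minus_distrib[of _ n] scalar_prod_add_distrib[of _ n]
        comm_scalar_prod[of y n x] algebra_simps)
  ultimately have "Im z = 0" by simp
  then have "A *\<^sub>v x = Re z \<cdot>\<^sub>v x" "A *\<^sub>v y = Re z \<cdot>\<^sub>v y"
    using xy by (auto simp: Ax Ay)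
  moreover have "x \<noteq> 0\<^sub>v n \<or> y \<noteq> 0\<^sub>v n"
    using \<open>x \<bullet> x + y \<bullet> y > 0\<close> by auto
  ultimately show ?thesis using xy A unfolding eigenvector_def by auto
qed

lemma orthonormal_matsD:
  assumes "U \<in> orthonormal_mats n"
  shows "U \<in> carrier_mat n n" "U * transpose_mat U = 1\<^sub>m n" "transpose_mat U * U = 1\<^sub>m n"
  using assms by (auto simp: orthonormal_mats_def)

lemma orthonormal_mats_transpose: "U \<in> orthonormal_mats n \<Longrightarrow> transpose_mat U \<in> orthonormal_mats n"
  by (auto simp: orthonormal_mats_def)

lemma orthonormal_mats_mult:
  assumes "U \<in> orthonormal_mats n" "V \<in> orthonormal_mats n"
  shows "U * V \<in> orthonormal_mats n"
proof -
  have [simp]: "U \<in> carrier_mat n n" "V \<in> carrier_mat n n"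
    "U * transpose_mat U = 1\<^sub>m n" "transpose_mat U * U = 1\<^sub>m n"
    "V * transpose_mat V = 1\<^sub>m n" "transpose_mat V * V = 1\<^sub>m n"
    using assms by (auto simp: orthonormal_mats_def)
  have "U * V * (transpose_mat V * transpose_mat U) = U * (V * transpose_mat V) * transpose_mat U"
    by (simp add: assoc_mult_mat[of _ n n _ n _ n] mult_carrier_mat[of _ n n _ n] del: \<open>V * transpose_mat V = 1\<^sub>m n\<close>)
  moreover have "transpose_mat V * transpose_mat U * (U * V) = transpose_mat V * (transpose_mat U * U) * V"
    by (simp add: assoc_mult_mat[of _ n n _ n _ n] mult_carrier_mat[of _ n n _ n] del: \<open>transpose_mat U * U = 1\<^sub>m n\<close>)
  ultimately show ?thesis
    by (auto simp: orthonormal_mats_def transpose_mult[of _ n n _ n] right_mult_one_mat[of _ n n]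
        intro: mult_carrier_mat[of _ n n])
qed

text \<open>Complete v to a basis and apply Gram-Schmidt, which keeps the first vector. It yields
  orthogonal vectors of arbitrary length, so the columns are rescaled afterwards; this is where the
  factor c comes from.\<close>

lemma orthonormal_mat_with_first_col:
  fixes v :: "real vec"
  assumes v: "v \<in> carrier_vec n" "v \<noteq> 0\<^sub>v n"
  shows "\<exists>W \<in> orthonormal_mats n. \<exists>c. col W 0 = c \<cdot>\<^sub>v v"
proof -
  interpret cof_vec_space n "TYPE(real)" .
  have n: "n > 0" using v by (cases n) auto
  define b where "b = basis_completion v"
  define ws where "ws = gram_schmidt n b"
  from basis_completion[OF v, folded b_def]
  have b: "distinct b" "\<not> lin_dep (set b)" "set b \<subseteq> carrier_vec n" "hd b = v" "length b = n"
    by auto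
  then obtain vs where bv: "b = v # vs" using n by (cases b) auto
  from gram_schmidt_result[OF b(3) b(1) b(2) refl, folded ws_def]
  have ws: "set ws \<subseteq> carrier_vec n" "corthogonal ws" "length ws = n" by (auto simp: b)
  have hd: "ws ! 0 = v"
    using gram_schmidt_hd[OF v(1), of vs, folded bv ws_def] ws(3) n by (metis hd_conv_nth length_0_conv less_numeral_extra(3))
  define W where "W = mat_of_cols n (map (\<lambda>u. (1 / sqrt (u \<bullet> u)) \<cdot>\<^sub>v u) ws)"
  have W: "W \<in> carrier_mat n n" using ws(3) mat_of_cols_carrier(1)[of n "map (\<lambda>u. (1 / sqrt (u \<bullet> u)) \<cdot>\<^sub>v u) ws"] by (simp add: W_def)
  have wc: "ws ! i \<in> carrier_vec n" if "i < n" for i using ws that by auto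
  have colW: "col W i = (1 / sqrt (ws ! i \<bullet> ws ! i)) \<cdot>\<^sub>v ws ! i" if "i < n" for i
    using that ws(3) wc[OF that] by (simp add: W_def)
  have orth: "ws ! i \<bullet> ws ! j = 0 \<longleftrightarrow> i \<noteq> j" if "i < n" "j < n" for i j
    using corthogonalD[OF ws(2)] that ws(3) by simp
  have nonneg: "ws ! i \<bullet> ws ! i \<ge> 0" for i
    by (simp add: scalar_prod_def sum_nonneg)
  have "transpose_mat W * W = 1\<^sub>m n"
  proof (rule eq_matI)
    fix i j assume "i < dim_row (1\<^sub>m n)" "j < dim_col (1\<^sub>m n)"
    then have ij: "i < n" "j < n" by auto
    have [simp]: "dim_vec (ws ! i) = n" "dim_vec (ws ! j) = n" using wc ij by auto
    have "(transpose_mat W * W) $$ (i, j) = col W i \<bullet> col W j"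
      using W ij by simp
    also have "\<dots> = (ws ! i \<bullet> ws ! j) / (sqrt (ws ! i \<bullet> ws ! i) * sqrt (ws ! j \<bullet> ws ! j))"
      using ij by (simp add: colW scalar_prod_def sum_divide_distrib field_simps)
    also have "\<dots> = 1\<^sub>m n $$ (i, j)"
      using orth[of i j] orth[of i i] ij nonneg[of i] by (auto simp flip: real_sqrt_mult)
    finally show "(transpose_mat W * W) $$ (i, j) = 1\<^sub>m n $$ (i, j)" .
  qed (use W in auto)
  moreover from this have "W * transpose_mat W = 1\<^sub>m n"
    using mat_mult_left_right_inverse[of "transpose_mat W" n W] W by simp
  ultimately have "W \<in> orthonormal_mats n" using W by (simp add: orthonormal_mats_def)
  then show ?thesis using colW[OF n] hd by metis
qed

lemma orthonormal_conj_cancel: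
  assumes U: "U \<in> orthonormal_mats n" and X: "X \<in> carrier_mat n n"
  shows "U * (transpose_mat U * X * U) * transpose_mat U = X"
proof -
  note U' = orthonormal_matsD[OF U]
  have "U * (transpose_mat U * X * U) * transpose_mat U = (U * transpose_mat U) * X * (U * transpose_mat U)"
    using U'(1) X by (simp add: assoc_mult_mat[of _ n n _ n _ n] mult_carrier_mat[of _ n n _ n])
  then show ?thesis using U' X by simp
qed

lemma orthonormal_conj_mult:
  assumes U: "U \<in> orthonormal_mats n" and X: "X \<in> carrier_mat n n" and Y: "Y \<in> carrier_mat n n"
  shows "(U * X * transpose_mat U) * (U * Y * transpose_mat U) = U * (X * Y) * transpose_mat U"
proof -
  note U' = orthonormal_matsD[OF U]
  have "(U * X * transpose_mat U) * (U * Y * transpose_mat U) = U * X * (transpose_mat U * U) * Y * transpose_mat U"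
    using U'(1) X Y by (simp add: assoc_mult_mat[of _ n n _ n _ n] mult_carrier_mat[of _ n n _ n])
  also have "\<dots> = U * (X * Y) * transpose_mat U"
    using U' X Y by (simp add: assoc_mult_mat[of _ n n _ n _ n] mult_carrier_mat[of _ n n _ n])
  finally show ?thesis .
qed

lemma transpose_conj:
  fixes U :: "'a::comm_semiring_0 mat"
  assumes "U \<in> carrier_mat n m" "X \<in> carrier_mat m m"
  shows "transpose_mat (U * X * transpose_mat U) = U * transpose_mat X * transpose_mat U"
  using assms by (simp add: transpose_mult[of _ n m _ n] transpose_mult[of _ m m _ n]
      mult_carrier_mat[of _ n m _ m] assoc_mult_mat[of _ n m _ m _ n])

lemma transpose_mat_diag [simp]: "transpose_mat (mat_diag n d) = mat_diag n d"
  by (rule eq_matI) (auto simp: mat_diag_def)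

text \<open>Deflation: in an orthonormal basis that starts with an eigenvector, A splits into a 1 x
  1 block and a symmetric block of size n, to which the induction hypothesis applies.\<close>

lemma real_spectral_theorem:
  fixes A :: "real mat"
  assumes "A \<in> carrier_mat n n" "transpose_mat A = A"
  shows "\<exists>U \<in> orthonormal_mats n. \<exists>d. A = U * mat_diag n d * transpose_mat U"
  using assms
proof (induction n arbitrary: A)
  case 0
  have "1\<^sub>m 0 \<in> orthonormal_mats 0" by (auto simp: orthonormal_mats_def)
  moreover have "A = 1\<^sub>m 0 * mat_diag 0 d * transpose_mat (1\<^sub>m 0)" for d
    by (rule eq_matI) (use 0 in \<open>auto simp: mat_diag_def\<close>)
  ultimately show ?case by blast
next
  case (Suc n)
  let ?n = "Suc n"
  obtain v e where "eigenvector A v e"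
    using symmetric_mat_real_eigenvector[OF Suc.prems] by auto
  then have v: "v \<in> carrier_vec ?n" "v \<noteq> 0\<^sub>v ?n" "A *\<^sub>v v = e \<cdot>\<^sub>v v"
    using Suc.prems by (auto simp: eigenvector_def)
  obtain W c where W: "W \<in> orthonormal_mats ?n" and col0: "col W 0 = c \<cdot>\<^sub>v v"
    using orthonormal_mat_with_first_col[OF v(1,2)] by auto
  note W' = orthonormal_matsD[OF W]
  define B where "B = transpose_mat W * A * W"
  have B: "B \<in> carrier_mat ?n ?n" using W' Suc.prems unfolding B_def by (metis mult_carrier_mat transpose_carrier_mat)
  have AB: "A = W * B * transpose_mat W"
    unfolding B_def using orthonormal_conj_cancel[OF W Suc.prems(1)] by simp
  have symB: "transpose_mat B = B"
    using transpose_conj[of "transpose_mat W" ?n ?n A] W' Suc.prems by (simp add: B_def)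
  have Bi0: "B $$ (i, 0) = (if i = 0 then e else 0)" if i: "i < ?n" for i
  proof -
    have "B $$ (i, 0) = (transpose_mat W * (A * W)) $$ (i, 0)"
      unfolding B_def using W' Suc.prems by (simp add: assoc_mult_mat[of _ ?n ?n _ ?n _ ?n])
    also have "\<dots> = col W i \<bullet> col (A * W) 0"
      using i W' Suc.prems by simp
    also have "col (A * W) 0 = A *\<^sub>v col W 0"
      by (rule col_mult2[OF Suc.prems(1) W'(1)]) simp
    also have "\<dots> = e \<cdot>\<^sub>v col W 0"
      using v Suc.prems by (simp add: col0 mult_mat_vec[of _ ?n ?n] smult_smult_assoc mult.commute)
    also have "col W i \<bullet> (e \<cdot>\<^sub>v col W 0) = e * (transpose_mat W * W) $$ (i, 0)"
      using i W'(1) by simp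
    also have "\<dots> = (if i = 0 then e else 0)" using i by (simp add: W')
    finally show ?thesis .
  qed
  \<comment> \<open>The eigenvector only controls the first column; symmetry carries the zeros over
    to the first row.\<close>
  have B0i: "B $$ (0, i) = (if i = 0 then e else 0)" if i: "i < ?n" for i
    using Bi0[OF i] arg_cong[OF symB, of "\<lambda>M. M $$ (i, 0)"] B i by simp
  define A3 where "A3 = mat n n (\<lambda>(i, j). B $$ (Suc i, Suc j))"
  have A3: "A3 \<in> carrier_mat n n" by (simp add: A3_def)
  have "transpose_mat A3 = A3"
  proof (rule eq_matI)
    fix i j assume "i < dim_row A3" "j < dim_col A3"
    then show "transpose_mat A3 $$ (i, j) = A3 $$ (i, j)"
      using arg_cong[OF symB, of "\<lambda>M. M $$ (Suc i, Suc j)"] B by (simp add: A3_def)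
  qed (auto simp: A3_def)
  from Suc.IH[OF A3 this] obtain V d where V: "V \<in> orthonormal_mats n"
    and A3_eq: "A3 = V * mat_diag n d * transpose_mat V" by auto
  note V' = orthonormal_matsD[OF V]
  \<comment> \<open>V acts on the last n coordinates and the first is fixed, so V1 diagonalizes B
    without disturbing the eigenvalue e already split off.\<close>
  define V1 where "V1 = four_block_mat (1\<^sub>m 1) (0\<^sub>m 1 n) (0\<^sub>m n 1) V"
  define D1 where "D1 = mat_diag ?n (case_nat e d)"
  have D1: "D1 = four_block_mat (mat_diag 1 (\<lambda>_. e)) (0\<^sub>m 1 n) (0\<^sub>m n 1) (mat_diag n d)"
    by (rule eq_matI) (auto simp: D1_def mat_diag_def split: nat.splits)
  have B_block: "B = four_block_mat (mat_diag 1 (\<lambda>_. e)) (0\<^sub>m 1 n) (0\<^sub>m n 1) A3"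
    by (rule eq_matI) (use B Bi0 B0i in \<open>auto simp: mat_diag_def A3_def\<close>)
  have V1t: "transpose_mat V1 = four_block_mat (1\<^sub>m 1) (0\<^sub>m 1 n) (0\<^sub>m n 1) (transpose_mat V)"
    unfolding V1_def by (subst transpose_four_block_mat) (use V' in auto)
  have V1c: "V1 \<in> carrier_mat ?n ?n" using V' by (auto simp: V1_def)
  have V1: "V1 \<in> orthonormal_mats ?n"
    unfolding orthonormal_mats_def
  proof (intro CollectI conjI V1c)
    show "V1 * transpose_mat V1 = 1\<^sub>m ?n" unfolding V1t unfolding V1_def
      by (subst mult_four_block_mat[of _ 1 1 _ n _ n _ _ 1 _ n]) (use V' in auto)
    show "transpose_mat V1 * V1 = 1\<^sub>m ?n" unfolding V1t unfolding V1_def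
      by (subst mult_four_block_mat[of _ 1 1 _ n _ n _ _ 1 _ n]) (use V' in auto)
  qed
  have "V1 * D1 = four_block_mat (mat_diag 1 (\<lambda>_. e)) (0\<^sub>m 1 n) (0\<^sub>m n 1) (V * mat_diag n d)"
    unfolding V1_def D1
    by (subst mult_four_block_mat[of _ 1 1 _ n _ n _ _ 1 _ n])
      (use V' in \<open>simp_all del: One_nat_def add: left_mult_one_mat[of _ 1 1] right_add_zero_mat[of _ 1 1]
        left_mult_zero_mat[of _ n n] left_mult_zero_mat[of _ 1 1] left_add_zero_mat[of _ n n]\<close>)
  then have "V1 * D1 * transpose_mat V1 = B"
    unfolding V1t B_block A3_eq
    by (simp del: One_nat_def, subst mult_four_block_mat[of _ 1 1 _ n _ n _ _ 1 _ n])
      (use V' in \<open>simp_all del: One_nat_def add: right_mult_one_mat[of _ 1 1] right_add_zero_mat[of _ 1 1]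
        right_mult_zero_mat[of _ n n] right_mult_zero_mat[of _ 1 1] left_add_zero_mat[of _ n n]
        mult_carrier_mat[of _ n n _ n]\<close>)
  then have "A = W * (V1 * D1 * transpose_mat V1) * transpose_mat W" using AB by simp
  also have "\<dots> = (W * V1) * D1 * transpose_mat (W * V1)"
    using W' V1c by (simp add: D1_def transpose_mult[of _ ?n ?n _ ?n] assoc_mult_mat[of _ ?n ?n _ ?n _ ?n]
      mult_carrier_mat[of _ ?n ?n _ ?n])
  finally show ?case using orthonormal_mats_mult[OF W V1] unfolding D1_def by blast
qed

section \<open>Inverses and pseudoinverses\<close>

text \<open>Penrose's argument: A X and A Y are symmetric idempotents with the column space of A,
  hence equal, and likewise X A = Y A. Then X = X A X = Y A Y = Y. Uniqueness is what gives the
  definite description in \<open>pseudoinverse\<close> its value.\<close>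

lemma pseudoinverse_unique:
  assumes A: "A \<in> carrier_mat n m" and X: "is_pseudoinverse A X" and Y: "is_pseudoinverse A Y"
  shows "X = Y"
proof -
  from X have X: "X \<in> carrier_mat m n" "A * X * A = A" "X * A * X = X"
    "transpose_mat (A * X) = A * X" "transpose_mat (X * A) = X * A"
    using A by (auto simp: is_pseudoinverse_def)
  from Y have Y: "Y \<in> carrier_mat m n" "A * Y * A = A" "Y * A * Y = Y"
    "transpose_mat (A * Y) = A * Y" "transpose_mat (Y * A) = Y * A"
    using A by (auto simp: is_pseudoinverse_def)
  have [simp]: "A * X \<in> carrier_mat n n" "A * Y \<in> carrier_mat n n"
    "X * A \<in> carrier_mat m m" "Y * A \<in> carrier_mat m m" using A X Y by auto
  note as = assoc_mult_mat[of _ n m _ n _ m] assoc_mult_mat[of _ m n _ m _ n] assoc_mult_mat[of _ n m _ m _ n] assoc_mult_mat[of _ n m _ n _ n] assoc_mult_mat[of _ m n _ m _ m]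
  have "A * X = (A * Y * A) * X" by (simp add: Y)
  also have "\<dots> = (A * Y) * (A * X)" using A X(1) Y(1) by (simp add: as)
  also have "\<dots> = transpose_mat ((A * X) * (A * Y))"
    by (simp add: transpose_mult[of _ n n _ n] X(4) Y(4))
  also have "(A * X) * (A * Y) = (A * X * A) * Y"
    using A X(1) Y(1) by (simp add: as)
  finally have AX: "A * X = A * Y" by (simp add: X Y)
  have "X * A = X * (A * Y * A)" by (simp add: Y)
  also have "\<dots> = (X * A) * (Y * A)"
    using A X(1) Y(1) by (simp add: as)
  also have "\<dots> = transpose_mat ((Y * A) * (X * A))"
    by (simp add: transpose_mult[of _ m m _ m] X(5) Y(5))
  also have "(Y * A) * (X * A) = Y * (A * X * A)"
    using A X(1) Y(1) by (simp add: as)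
  finally have XA: "X * A = Y * A" by (simp add: X Y)
  have "X = Y * A * X" using X(3) XA by simp
  also have "\<dots> = Y * (A * X)" using A X(1) Y(1) by (simp add: as)
  also have "\<dots> = Y * A * Y" using A Y(1) by (simp add: AX as)
  also have "\<dots> = Y" by (rule Y)
  finally show ?thesis .
qed

lemma pseudoinverse_eqI:
  "A \<in> carrier_mat n m \<Longrightarrow> is_pseudoinverse A X \<Longrightarrow> pseudoinverse A = X"
  unfolding pseudoinverse_def using pseudoinverse_unique by blast

text \<open>For fixed U the matrices \<open>?f d\<close> are symmetric and multiply entrywise in d,
  so the four Penrose equations reduce to scalar identities. At a zero of d these hold because
  \<open>inverse 0 = 0\<close>.\<close>

lemma is_pseudoinverse_spectral:
  assumes U: "U \<in> orthonormal_mats n"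
  shows "is_pseudoinverse (U * mat_diag n d * transpose_mat U)
           (U * mat_diag n (\<lambda>i. inverse (d i)) * transpose_mat U)"
proof -
  let ?f = "\<lambda>d. U * mat_diag n d * transpose_mat U"
  have c: "?f d \<in> carrier_mat n n" for d
    using orthonormal_matsD[OF U] by (auto intro!: mult_carrier_mat)
  have m: "?f d * ?f e = ?f (\<lambda>i. d i * e i)" for d e
    by (simp add: orthonormal_conj_mult[OF U])
  have t: "transpose_mat (?f d) = ?f d" for d
    using transpose_conj[of U n n "mat_diag n d"] orthonormal_matsD[OF U] by simp
  have e: "(\<lambda>i. d i * inverse (d i) * d i) = d"
    "(\<lambda>i. inverse (d i) * d i * inverse (d i)) = (\<lambda>i. inverse (d i))" by (auto simp: fun_eq_iff field_split_simps)
  show ?thesis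
    unfolding is_pseudoinverse_def m t e using c orthonormal_matsD(1)[OF U] by auto
qed

lemma inverse_mat_eqI:
  assumes "A \<in> carrier_mat n n" "X \<in> carrier_mat n n" "A * X = 1\<^sub>m n" "X * A = 1\<^sub>m n"
  shows "inverse_mat A = X"
proof -
  \<comment> \<open>Being a unit of the matrix ring excludes the result \<open>None\<close> of
    \<open>mat_inverse\<close>.\<close>
  have "A \<in> Units (ring_mat TYPE(real) n ())"
    using assms by (auto simp: Units_def ring_mat_def)
  then obtain B where inv: "mat_inverse A = Some B"
    using mat_inverse(1)[OF assms(1), where b = "()"] by blast
  from mat_inverse(2)[OF assms(1) this] have B: "B * A = 1\<^sub>m n" "B \<in> carrier_mat n n" by auto
  have "B = B * (A * X)" using assms B right_mult_one_mat[of B n n] by simp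
  also have "\<dots> = B * A * X" by (rule assoc_mult_mat[symmetric]) (use assms B in auto)
  also have "\<dots> = X" using assms B left_mult_one_mat[of X n n] by simp
  finally show ?thesis using inv by (simp add: inverse_mat_def)
qed

section \<open>Characteristic polynomials\<close>

lemma char_poly_nonzero: "A \<in> carrier_mat n n \<Longrightarrow> char_poly (A :: 'a::idom mat) \<noteq> 0"
  using degree_monic_char_poly[of A n] by (metis coeff_0 zero_neq_one)

lemma proots_prod_linear_factors:
  "proots (\<Prod>a\<leftarrow>as. [:- a, 1:] :: 'a::idom poly) = mset as"
proof (induction as)
  case (Cons a as)
  have "(\<Prod>a\<leftarrow>as. [:- a, 1:]) \<noteq> 0" by (auto simp: prod_list_zero_iff)
  then have "proots ([:- a, 1:] * (\<Prod>a\<leftarrow>as. [:- a, 1:])) = proots [:- a, 1:] + proots (\<Prod>a\<leftarrow>as. [:- a, 1:])"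
    by (intro proots_mult) auto
  then show ?case by (simp add: Cons.IH)
qed simp

lemma char_poly_mat_diag:
  "char_poly (mat_diag n d :: 'a::comm_ring_1 mat) = (\<Prod>a\<leftarrow>map d [0..<n]. [:- a, 1:])"
proof -
  have "diag_mat (mat_diag n d) = map d [0..<n]"
    by (auto simp: diag_mat_def mat_diag_def)
  moreover have "upper_triangular (mat_diag n d)"
    by (auto simp: mat_diag_def upper_triangular_def)
  ultimately show ?thesis using char_poly_upper_triangular[OF mat_diag_dim] by metis
qed

lemma char_poly_spectral:
  assumes U: "U \<in> orthonormal_mats n"
  shows "char_poly (U * mat_diag n d * transpose_mat U) = (\<Prod>a\<leftarrow>map d [0..<n]. [:- a, 1:])"
proof -
  have "similar_mat_wit (U * mat_diag n d * transpose_mat U) (mat_diag n d) U (transpose_mat U)"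
    by (rule similar_mat_witI[of _ _ n]) (use orthonormal_matsD[OF U] in \<open>auto intro!: mult_carrier_mat\<close>)
  then show ?thesis
    using char_poly_similar char_poly_mat_diag unfolding similar_mat_def by metis
qed

lemma proots_char_poly_spectral:
  assumes "U \<in> orthonormal_mats n"
  shows "proots (char_poly (U * mat_diag n d * transpose_mat U)) = mset (map d [0..<n])"
  unfolding char_poly_spectral[OF assms] by (rule proots_prod_linear_factors)

lemma mult_transpose_self_symmetric:
  fixes B :: "'a::comm_semiring_0 mat"
  assumes "B \<in> carrier_mat n m"
  shows "transpose_mat (B * transpose_mat B) = B * transpose_mat B"
  using assms by (simp add: transpose_mult[of _ n m _ n])

(* Conjugation by [[1, B], [0, 1]] carries [[0, 0], [B^T, B^T B]] to [[B B^T, 0], [B^T, 0]]. *)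
lemma proots_char_poly_mult_transpose:
  fixes B :: "real mat"
  assumes B: "B \<in> carrier_mat n m"
  shows "proots (char_poly (B * transpose_mat B)) + replicate_mset m 0 =
         proots (char_poly (transpose_mat B * B)) + replicate_mset n 0"
proof -
  let ?T = "transpose_mat B"
  have T: "?T \<in> carrier_mat m n" and BT: "B * ?T \<in> carrier_mat n n" and TB: "?T * B \<in> carrier_mat m m"
    using B by auto
  \<comment> \<open>The product rule \<open>char_poly_0_block'\<close> wants the diagonal blocks to
    have characteristic polynomials that split into linear factors. Over the reals this comes from
    the spectral theorem, since all these blocks are symmetric.\<close>
  have split: "\<exists>as. char_poly X = (\<Prod>a\<leftarrow>as. [:- a, 1:])"
    if "X \<in> carrier_mat k k" "transpose_mat X = X" for X :: "real mat" and k
    using real_spectral_theorem[OF that] char_poly_spectral by metis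
  have z: "(0\<^sub>m k k :: real mat) = mat_diag k (\<lambda>_. 0)" for k
    by (rule eq_matI) (auto simp: mat_diag_def)
  define M1 where "M1 = four_block_mat (B * ?T) (0\<^sub>m n m) ?T (0\<^sub>m m m)"
  define M2 where "M2 = four_block_mat (0\<^sub>m n n) (0\<^sub>m n m) ?T (?T * B)"
  define P where "P = four_block_mat (1\<^sub>m n) B (0\<^sub>m m n) (1\<^sub>m m)"
  define P' where "P' = four_block_mat (1\<^sub>m n) (- B) (0\<^sub>m m n) (1\<^sub>m m)"
  have carr: "M1 \<in> carrier_mat (n + m) (n + m)" "M2 \<in> carrier_mat (n + m) (n + m)"
    "P \<in> carrier_mat (n + m) (n + m)" "P' \<in> carrier_mat (n + m) (n + m)"
    using BT TB by (auto simp: M1_def M2_def P_def P'_def)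
  have neg: "- 0\<^sub>m m m + 1\<^sub>m m = (1\<^sub>m m :: real mat)" "- B + B = 0\<^sub>m n m" "B + - B = 0\<^sub>m n m"
    "B * 0\<^sub>m m n = 0\<^sub>m n n"
    by (rule eq_matI; use B in auto)+
  have PP': "P * P' = 1\<^sub>m (n + m)"
    unfolding P_def P'_def
    by (subst mult_four_block_mat[of _ n n _ m _ m _ _ n _ m])
      (use B in \<open>simp_all add: left_mult_one_mat[of _ n m] right_mult_one_mat[of _ n m] neg left_mult_zero_mat[of _ n m]\<close>)
  have P'P: "P' * P = 1\<^sub>m (n + m)"
    unfolding P_def P'_def
    by (subst mult_four_block_mat[of _ n n _ m _ m _ _ n _ m])
      (use B in \<open>simp_all add: left_mult_one_mat[of _ n m] right_mult_one_mat[of _ n m] neg left_mult_zero_mat[of _ n m]\<close>)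
  have "P * M2 = four_block_mat (B * ?T) (B * (?T * B)) ?T (?T * B)"
    unfolding P_def M2_def
    by (subst mult_four_block_mat[of _ n n _ m _ m _ _ n _ m]) (use B in \<open>simp_all add: left_mult_one_mat[of _ m n]
        left_mult_one_mat[of _ m m]\<close>)
  moreover have "M1 * P = four_block_mat (B * ?T) (B * ?T * B) ?T (?T * B)"
    unfolding P_def M1_def
    by (subst mult_four_block_mat[of _ n n _ m _ m _ _ n _ m]) (use B in \<open>simp_all add: right_mult_one_mat[of _ n n]
        right_mult_one_mat[of _ m n]\<close>)
  ultimately have "P * M2 = M1 * P" using B by (simp add: assoc_mult_mat[of _ n m _ n _ m])
  then have "P * M2 * P' = M1 * (P * P')" using carr by (simp add: assoc_mult_mat[of _ "n+m" "n+m" _ "n+m" _ "n+m"])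
  then have "M1 = P * M2 * P'" using carr by (simp add: PP' right_mult_one_mat[of _ "n+m" "n+m"])
  then have "similar_mat M1 M2"
    using similar_mat_witI[OF PP' P'P _ carr] unfolding similar_mat_def by blast
  then have "char_poly M1 = char_poly M2" by (rule char_poly_similar)
  moreover have "char_poly M1 = char_poly (B * ?T) * char_poly (0\<^sub>m m m)"
    by (rule char_poly_0_block'[OF M1_def _ _ BT T])
      (use split[OF BT] split[of "0\<^sub>m m m" m] mult_transpose_self_symmetric[OF B] in auto)
  moreover have "char_poly M2 = char_poly (0\<^sub>m n n) * char_poly (?T * B)"
    by (rule char_poly_0_block'[OF M2_def _ _ _ T TB])
      (use split[OF TB] split[of "0\<^sub>m n n" n] mult_transpose_self_symmetric[OF T] in auto)
  \<comment> \<open>With t the variable this reads t^m char(B B^T) = t^n char(B^T B). Padding both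
    sides with zeros treats n \<le> m and m \<le> n alike.\<close>
  ultimately have "char_poly (B * ?T) * char_poly (0\<^sub>m m m) = char_poly (0\<^sub>m n n) * char_poly (?T * B)"
    by simp
  then have "proots (char_poly (B * ?T)) + proots (char_poly (0\<^sub>m m m)) =
      proots (char_poly (0\<^sub>m n n)) + proots (char_poly (?T * B))"
    using char_poly_nonzero[OF BT] char_poly_nonzero[OF TB] char_poly_nonzero[OF zero_carrier_mat]
    by (metis proots_mult)
  moreover have "proots (char_poly (0\<^sub>m k k :: real mat)) = replicate_mset k 0" for k
    unfolding z char_poly_mat_diag proots_prod_linear_factors
    by (simp add: map_replicate_const)
  ultimately show ?thesis by (simp add: add.commute)
qed

section \<open>Rank\<close>

text \<open>Column j of A B is the combination of the columns of A whose coefficients are the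
  entries of column j of B.\<close>

lemma (in vec_space) span_cols_mult:
  assumes A: "A \<in> carrier_mat n m" and B: "B \<in> carrier_mat m k"
  shows "span (set (cols (A * B))) \<subseteq> span (set (cols A))"
proof (rule span_subsetI)
  show c: "set (cols A) \<subseteq> carrier_vec n" using A cols_dim by blast
  have "col (A * B) j \<in> span (set (cols A))" if "j < k" for j
  proof -
    have "col (A * B) j = A *\<^sub>v col B j" by (rule col_mult2[OF A B that])
    also have "\<dots> = mat_of_cols n (cols A) *\<^sub>v vec (length (cols A)) (\<lambda>i. col B j $ i)"
      using A B by (intro arg_cong2[of _ _ _ _ "(*\<^sub>v)"] eq_vecI) auto
    also have "\<dots> = lincomb_list (\<lambda>i. col B j $ i) (cols A)"
      by (rule lincomb_list_as_mat_mult[symmetric]) (use c in auto)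
    also have "\<dots> \<in> span (set (cols A))"
      using span_list_as_span[OF c] by (auto simp: span_list_def)
    finally show ?thesis .
  qed
  then show "set (cols (A * B)) \<subseteq> span (set (cols A))"
    using A B by (auto simp: cols_def)
qed

text \<open>The column spaces coincide: one inclusion comes from the product A B, the other from A =
  (A B) C.\<close>

lemma (in vec_space) rank_mult_invertible:
  assumes A: "A \<in> carrier_mat n m" and B: "B \<in> carrier_mat m m" "C \<in> carrier_mat m m" "B * C = 1\<^sub>m m"
  shows "rank (A * B) = rank A"
proof -
  have "A * B * C = A" using A B by (simp add: assoc_mult_mat[of _ n m _ m _ m])
  then have "span (set (cols (A * B))) = span (set (cols A))"
    using span_cols_mult[OF A B(1)] span_cols_mult[of "A * B" m C m] A B by auto
  then show ?thesis by (simp add: rank_def)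
qed

text \<open>The columns of W are orthogonal for the positive definite form with weights a, and d i
  is the squared length of column i. Columns with d i = 0 vanish, the others are independent.
  Keeping the weights in the form rather than in the matrix lets the lemma speak of the rank of the
  unscaled matrix.\<close>

lemma rank_weighted_orthogonal_cols:
  fixes W :: "real mat"
  assumes W: "W \<in> carrier_mat n m" and a: "\<And>k. k < n \<Longrightarrow> a k > 0"
    and orth: "\<And>i j. i < m \<Longrightarrow> j < m \<Longrightarrow>
      (\<Sum>k<n. a k * W $$ (k, i) * W $$ (k, j)) = (if i = j then d i else 0)"
  shows "vec_space.rank n W = card {i. i < m \<and> d i \<noteq> 0}"
proof -
  interpret vec_space "TYPE(real)" n .
  define I where "I = {i. i < m \<and> d i \<noteq> 0}"
  define S where "S = col W ` I"
  have Sc: "S \<subseteq> carrier_vec n" using W by (auto simp: S_def)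
  have finS: "finite S" by (simp add: S_def I_def)
  \<comment> \<open>\<open>S\<close> is a set of vectors, so equal columns would collapse. Two equal
    columns with distinct indices in \<open>I\<close> would be orthogonal to themselves, forcing d i
    = 0.\<close>
  have inj: "inj_on (col W) I"
  proof (rule inj_onI, rule ccontr)
    fix i j assume ij: "i \<in> I" "j \<in> I" "col W i = col W j" "i \<noteq> j"
    have "W $$ (k, i) = W $$ (k, j)" if "k < n" for k
      using arg_cong[OF ij(3), of "\<lambda>v. v $ k"] ij(1,2) that W by (auto simp: I_def)
    then have "(\<Sum>k<n. a k * W $$ (k, i) * W $$ (k, i)) = (\<Sum>k<n. a k * W $$ (k, i) * W $$ (k, j))"
      by (intro sum.cong) auto
    then show False using ij orth[of i i] orth[of i j] by (auto simp: I_def)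
  qed
  have indpt: "lin_indpt S"
  proof
    assume "lin_dep S"
    from finite_lin_dep[OF finS this Sc] obtain c w where
      c: "lincomb c S = 0\<^sub>v n" "w \<in> S" "c w \<noteq> 0" by auto
    then obtain i where i: "i \<in> I" "w = col W i" by (auto simp: S_def)
    \<comment> \<open>Pairing the dependence relation with column i removes every term except c w *
      d i, which is nonzero.\<close>
    have "0 = (\<Sum>k<n. a k * W $$ (k, i) * lincomb c S $ k)" by (simp add: c)
    also have "\<dots> = (\<Sum>k<n. \<Sum>j\<in>I. a k * W $$ (k, i) * (c (col W j) * W $$ (k, j)))"
    proof (rule sum.cong[OF refl])
      fix k assume k: "k \<in> {..<n}"
      have "lincomb c S $ k = (\<Sum>j\<in>I. c (col W j) * col W j $ k)"
        using k Sc by (simp add: lincomb_index S_def sum.reindex[OF inj])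
      also have "\<dots> = (\<Sum>j\<in>I. c (col W j) * W $$ (k, j))"
        using k W by (intro sum.cong) (auto simp: I_def)
      finally show "a k * W $$ (k, i) * lincomb c S $ k =
          (\<Sum>j\<in>I. a k * W $$ (k, i) * (c (col W j) * W $$ (k, j)))"
        by (simp add: sum_distrib_left)
    qed
    also have "\<dots> = (\<Sum>j\<in>I. c (col W j) * (\<Sum>k<n. a k * W $$ (k, i) * W $$ (k, j)))"
      by (subst sum.swap) (simp add: sum_distrib_left mult_ac)
    also have "\<dots> = (\<Sum>j\<in>I. if i = j then c (col W j) * d i else 0)"
      using i by (intro sum.cong) (auto simp: orth I_def)
    also have "\<dots> = c w * d i" using i by (simp add: I_def)
    finally show False using c i by (auto simp: I_def)
  qed
  have zero: "col W i = 0\<^sub>v n" if "i < m" "i \<notin> I" for i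
  proof (rule eq_vecI)
    fix k assume "k < dim_vec (0\<^sub>v n)"
    then have k: "k < n" by simp
    have "(\<Sum>k<n. a k * (W $$ (k, i))\<^sup>2) = 0"
      using orth[of i i] that by (simp add: I_def power2_eq_square mult.assoc)
    then have "a k * (W $$ (k, i))\<^sup>2 = 0"
      using a k by (subst (asm) sum_nonneg_eq_0_iff) (auto simp: less_imp_le)
    then show "col W i $ k = 0\<^sub>v n $ k" using a[OF k] k W that by simp
  qed (use W in auto)
  \<comment> \<open>All columns outside \<open>S\<close> are zero, and an independent set cannot
    contain the zero vector; so nothing can be added to \<open>S\<close>.\<close>
  have "maximal S (\<lambda>T. T \<subseteq> set (cols W) \<and> lin_indpt T)"
    unfolding maximal_def
  proof (intro conjI allI impI indpt)
    show "S \<subseteq> set (cols W)" using W by (auto simp: S_def I_def cols_def)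
    fix T assume T: "S \<subseteq> T \<and> T \<subseteq> set (cols W) \<and> lin_indpt T"
    moreover have "set (cols W) \<subseteq> carrier_vec n" using W cols_dim by blast
    ultimately have nz: "0\<^sub>v n \<notin> T" using vs_zero_lin_dep[of T] by auto
    have "T \<subseteq> S"
    proof
      fix x assume x: "x \<in> T"
      then obtain i where i: "i < m" "x = col W i" using T W by (auto simp: cols_def)
      then have "i \<in> I" using nz zero x by metis
      then show "x \<in> S" using i by (simp add: S_def)
    qed
    then show "T = S" using T by blast
  qed
  from rank_card_indpt[OF W this] show ?thesis
    using card_image[OF inj] by (simp add: S_def I_def)
qed

section \<open>Ordered eigenvalues\<close>

lemma eigvals_desc_eq_positive_part:
  assumes "proots (char_poly A) = P + replicate_mset k 0" and "\<And>x. x \<in># P \<Longrightarrow> x > 0"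
  shows "eigvals_desc A = rev (sorted_list_of_multiset P) @ replicate k 0"
proof -
  let ?xs = "replicate k 0 @ sorted_list_of_multiset P"
  have "mset ?xs = P + replicate_mset k 0" by (simp add: add.commute)
  moreover have "sorted ?xs" using assms(2) by (auto simp: sorted_append less_imp_le)
  ultimately have "sorted_list_of_multiset (P + replicate_mset k 0) = ?xs"
    by (metis sorted_list_of_multiset_mset sorted_sort_id)
  then show ?thesis by (simp add: eigvals_desc_def assms(1))
qed

text \<open>\<open>inverse\<close> is antitone on the positive reals, which is why positivity is
  assumed and the order flips.\<close>

lemma sorted_list_of_multiset_image_inverse:
  fixes P :: "real multiset"
  assumes "\<And>x. x \<in># P \<Longrightarrow> x > 0"
  shows "sorted_list_of_multiset (image_mset inverse P) = rev (map inverse (sorted_list_of_multiset P))"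
proof -
  let ?ys = "sorted_list_of_multiset P"
  have "sorted (rev (map inverse ?ys))"
    unfolding sorted_wrt_rev sorted_wrt_map
    by (rule sorted_wrt_mono_rel[OF _ sorted_sorted_list_of_multiset]) (use assms in \<open>auto intro: le_imp_inverse_le\<close>)
  moreover have "mset (rev (map inverse ?ys)) = image_mset inverse P" by simp
  ultimately show ?thesis by (metis sorted_list_of_multiset_mset sorted_sort_id)
qed

text \<open>\<open>eigval\<close> counts from 1 and list positions from 0; the length bound keeps
  every access inside the list.\<close>

lemma map_eigval:
  assumes "n \<le> length (eigvals_desc A)"
  shows "map (eigval A) [1..<n + 1] = take n (eigvals_desc A)"
  using assms by (auto simp: eigval_def list_eq_iff_nth_eq simp del: upt_Suc)

lemma map_reciprocal_eigval_rev:
  assumes "n \<le> length (eigvals_desc A)"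
  shows "map (\<lambda>k. 1 / eigval A k) (rev [1..<n + 1]) = rev (map inverse (take n (eigvals_desc A)))"
proof -
  have "map (\<lambda>k. 1 / eigval A k) (rev [1..<n + 1]) = rev (map inverse (map (eigval A) [1..<n + 1]))"
    by (simp add: rev_map inverse_eq_divide comp_def del: upt_Suc)
  then show ?thesis by (simp only: map_eigval[OF assms])
qed

text \<open>In the rotated coordinates y = U^T x the quadratic form is the sum of d_i y_i^2. The
  lemma is what permits evaluating \<Phi> through \<phi>, as their relation is given on
  \<open>nnd_mats\<close> only.\<close>

lemma spectral_in_nnd_mats:
  assumes U: "U \<in> orthonormal_mats n" and d: "\<And>i. i < n \<Longrightarrow> d i \<ge> 0"
  shows "U * mat_diag n d * transpose_mat U \<in> nnd_mats n"
  unfolding nnd_mats_def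
proof (intro CollectI conjI ballI)
  note U' = orthonormal_matsD[OF U]
  show "U * mat_diag n d * transpose_mat U \<in> carrier_mat n n"
    using U' by (auto intro!: mult_carrier_mat)
  show "transpose_mat (U * mat_diag n d * transpose_mat U) = U * mat_diag n d * transpose_mat U"
    using transpose_conj[of U n n "mat_diag n d"] U' by simp
  fix x :: "real vec" assume x: "x \<in> carrier_vec n"
  define y where "y = transpose_mat U *\<^sub>v x"
  have y: "y \<in> carrier_vec n" unfolding y_def by (rule mult_mat_vec_carrier[of _ n n]) (use U' x in auto)
  have "(U * mat_diag n d * transpose_mat U) *\<^sub>v x = U *\<^sub>v (mat_diag n d *\<^sub>v y)"
    using U' x by (simp add: y_def assoc_mult_mat_vec[of _ n n _ n] mult_carrier_mat[of _ n n _ n])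
  moreover have "x \<bullet> (U *\<^sub>v (mat_diag n d *\<^sub>v y)) = y \<bullet> (mat_diag n d *\<^sub>v y)"
    unfolding y_def by (rule transpose_vec_mult_scalar[symmetric])
      (use U' x y in \<open>auto simp: y_def intro!: mult_mat_vec_carrier[of _ n n]\<close>)
  ultimately have "x \<bullet> ((U * mat_diag n d * transpose_mat U) *\<^sub>v x) = y \<bullet> (mat_diag n d *\<^sub>v y)"
    by simp
  also have "\<dots> = (\<Sum>i<n. d i * (y $ i)\<^sup>2)"
  proof -
    have "(mat_diag n d *\<^sub>v y) $ i = d i * y $ i" if "i < n" for i
      using that y by (simp add: mat_diag_def scalar_prod_def atLeast0LessThan
          if_distrib[of "\<lambda>c. c * _"] cong: if_cong)
    then show ?thesis
      using y by (simp add: scalar_prod_def atLeast0LessThan mat_diag_def power2_eq_square mult_ac del: index_mult_mat_vec)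
  qed
  also have "\<dots> \<ge> 0" using d by (intro sum_nonneg) auto
  finally show "0 \<le> x \<bullet> ((U * mat_diag n d * transpose_mat U) *\<^sub>v x)" .
qed

section \<open>The criterion value\<close>

lemma inverse_moment_mat:
  assumes "feasible_design v w"
  shows "inverse_mat (moment_mat w) = mat_diag v (\<lambda>i. 1 / w $ i)"
proof (rule inverse_mat_eqI[of _ v])
  have w: "dim_vec w = v" "\<And>i. i < v \<Longrightarrow> w $ i > 0"
    using assms by (auto simp: feasible_design_def design_def)
  have 1: "mat_diag v f = 1\<^sub>m v" if "\<And>i. i < v \<Longrightarrow> f i = 1" for f :: "nat \<Rightarrow> real"
    by (rule eq_matI) (use that in \<open>auto simp: mat_diag_def\<close>)
  show "moment_mat w * mat_diag v (\<lambda>i. 1 / w $ i) = 1\<^sub>m v" "mat_diag v (\<lambda>i. 1 / w $ i) * moment_mat w = 1\<^sub>m v"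
    by (auto simp: moment_mat_def w intro!: 1) (use w(2) in force)+
qed (use assms in \<open>auto simp: moment_mat_def feasible_design_def design_def\<close>)

text \<open>\<open>P\<close> is the common multiset of nonzero eigenvalues of the Gram matrix B^T B
  and of L = B B^T, where B = D Q; its size is tied to the rank of Q itself.\<close>

lemma weighted_gram_spectrum:
  fixes Q :: "real mat" and a :: "nat \<Rightarrow> real"
  assumes Q: "Q \<in> carrier_mat v s" and a: "\<And>i. i < v \<Longrightarrow> a i > 0"
  defines "r \<equiv> vec_space.rank v Q"
    and "L \<equiv> mat_diag v (\<lambda>i. sqrt (a i)) * Q * transpose_mat Q * mat_diag v (\<lambda>i. sqrt (a i))"
  obtains U d P where "U \<in> orthonormal_mats s"
    "transpose_mat Q * mat_diag v a * Q = U * mat_diag s d * transpose_mat U"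
    "\<And>i. i < s \<Longrightarrow> d i \<ge> 0" "size P = r" "r \<le> s" "\<And>x. x \<in># P \<Longrightarrow> x > 0"
    "mset (map d [0..<s]) = P + replicate_mset (s - r) 0"
    "proots (char_poly L) = P + replicate_mset (v - r) 0"
proof -
  define D where "D = mat_diag v (\<lambda>i. sqrt (a i))"
  define B where "B = D * Q"
  have D: "D \<in> carrier_mat v v" "transpose_mat D = D" by (simp_all add: D_def)
  have B: "B \<in> carrier_mat v s" using D Q by (auto simp: B_def)
  have Bt: "transpose_mat B = transpose_mat Q * D"
    using D Q by (simp add: B_def transpose_mult[of _ v v _ s])
  have LB: "L = B * transpose_mat B"
    unfolding L_def Bt unfolding B_def D_def[symmetric]
    using D Q by (simp add: assoc_mult_mat[of _ v v _ s _ v] assoc_mult_mat[of _ v s _ v _ v]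
        assoc_mult_mat[of _ v v _ v _ v] mult_carrier_mat[of _ v s _ v])
  have "D * D = mat_diag v a"
    unfolding D_def mat_diag_diag
    by (rule eq_matI) (use a in \<open>auto simp: mat_diag_def less_imp_le\<close>)
  then have BB: "transpose_mat B * B = transpose_mat Q * mat_diag v a * Q"
    unfolding Bt unfolding B_def
    using D Q by (simp add: assoc_mult_mat[of _ s v _ v _ s] assoc_mult_mat[of _ v v _ v _ s]
        flip: \<open>D * D = mat_diag v a\<close>)
  have BBc: "transpose_mat B * B \<in> carrier_mat s s" using B by auto
  have "transpose_mat (transpose_mat B * B) = transpose_mat B * B"
    using mult_transpose_self_symmetric[of "transpose_mat B" s v] B by simp
  from real_spectral_theorem[OF BBc this] obtain U d where U: "U \<in> orthonormal_mats s"
    and Ud: "transpose_mat B * B = U * mat_diag s d * transpose_mat U" by auto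
  note U' = orthonormal_matsD[OF U]
  \<comment> \<open>Diagonalizing Q^T diag(a) Q by U says exactly that the columns of Q U are
    orthogonal for the weights a, with squared lengths d. So the rank of Q counts the nonzero d
    i.\<close>
  define W where "W = Q * U"
  have W: "W \<in> carrier_mat v s" using Q U' by (auto simp: W_def)
  have Wt: "transpose_mat W = transpose_mat U * transpose_mat Q"
    using Q U' by (simp add: W_def transpose_mult[of _ v s _ s])
  have "transpose_mat W * (mat_diag v a * W) = transpose_mat U * (transpose_mat Q * mat_diag v a * Q) * U"
    unfolding Wt unfolding W_def using Q U'(1)
    by (simp add: assoc_mult_mat[of _ v v _ s _ s] assoc_mult_mat[of _ s s _ v _ s] assoc_mult_mat[of _ s v _ v _ s]
        assoc_mult_mat[of _ s v _ s _ s] assoc_mult_mat[of _ s s _ s _ s] mult_carrier_mat[of _ v s _ s]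
        mult_carrier_mat[of _ v v _ s] mult_carrier_mat[of _ s v _ s])
  also have "\<dots> = mat_diag s d"
    using orthonormal_conj_cancel[OF orthonormal_mats_transpose[OF U] mat_diag_dim[of s d]] Ud BB by simp
  finally have WW: "transpose_mat W * (mat_diag v a * W) = mat_diag s d" .
  have orth: "(\<Sum>k<v. a k * W $$ (k, i) * W $$ (k, j)) = (if i = j then d i else 0)"
    if "i < s" "j < s" for i j
  proof -
    have "(\<Sum>k<v. a k * W $$ (k, i) * W $$ (k, j)) = (transpose_mat W * (mat_diag v a * W)) $$ (i, j)"
      using that W by (simp add: mat_diag_mult_left[OF W] scalar_prod_def atLeast0LessThan mult_ac)
    then show ?thesis using that unfolding WW by (simp add: mat_diag_def)
  qed
  have "r = vec_space.rank v W"
    unfolding r_def W_def using U' Q by (intro vec_space.rank_mult_invertible[symmetric]) auto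
  also have "\<dots> = card {i. i < s \<and> d i \<noteq> 0}"
    by (rule rank_weighted_orthogonal_cols[OF W a orth])
  finally have r: "r = card {i. i < s \<and> d i \<noteq> 0}" .
  \<comment> \<open>Nonnegativity needs no separate argument about B^T B: d i is a weighted squared
    length.\<close>
  have d: "d i \<ge> 0" if "i < s" for i
  proof -
    have "d i = (\<Sum>k<v. a k * (W $$ (k, i))\<^sup>2)"
      using orth[OF that that] by (simp add: power2_eq_square mult.assoc)
    also have "\<dots> \<ge> 0" using a by (intro sum_nonneg) (auto simp: less_imp_le)
    finally show ?thesis .
  qed
  define P where "P = filter_mset (\<lambda>x. x \<noteq> 0) (mset (map d [0..<s]))"
  have size: "size P = r"
  proof -
    have "P = mset (map d (filter (\<lambda>i. d i \<noteq> 0) [0..<s]))"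
      by (simp only: P_def mset_filter[symmetric] filter_map comp_def)
    then have "size P = length (filter (\<lambda>i. d i \<noteq> 0) [0..<s])"
      by (simp only: size_mset length_map)
    also have "\<dots> = card {i. i < s \<and> d i \<noteq> 0}"
      by (subst distinct_card[symmetric]) (auto intro: arg_cong[of _ _ card])
    finally show ?thesis using r by simp
  qed
  have rs: "r \<le> s" unfolding r using card_mono[of "{..<s}" "{i. i < s \<and> d i \<noteq> 0}"] by auto
  have pos: "x > 0" if "x \<in># P" for x using that d by (force simp: P_def less_le)
  define K where "K = filter_mset (\<lambda>x. x = 0) (mset (map d [0..<s]))"
  have dPK: "mset (map d [0..<s]) = P + K"
    unfolding P_def K_def using multiset_partition[of _ "\<lambda>x. x \<noteq> 0"] by simp
  have "K = replicate_mset (size K) 0"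
    by (rule multiset_eqI) (auto simp: K_def filter_eq_replicate_mset)
  moreover have "size K = s - r"
    using arg_cong[OF dPK, of size] size by simp
  ultimately have dP: "mset (map d [0..<s]) = P + replicate_mset (s - r) 0" using dPK by simp
  have key: "proots (char_poly L) + replicate_mset s 0 = P + replicate_mset (s - r) 0 + replicate_mset v 0"
    using proots_char_poly_mult_transpose[OF B] proots_char_poly_spectral[OF U, of d]
    by (simp add: LB Ud dP del: mset_map)
  have "count P 0 = 0" using pos by (force simp: count_eq_zero_iff)
  \<comment> \<open>At x = 0, with c the multiplicity of 0 for L, \<open>key\<close> says c + s = (s
    - r) + v. As r \<le> s this gives c + r = v, so v - r is a genuine difference.\<close>
  then have "count (proots (char_poly L)) x = count (P + replicate_mset (v - r) 0) x" for x
    using rs arg_cong[OF key, of "\<lambda>M. count M x"] by (cases "x = 0") auto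
  then have "proots (char_poly L) = P + replicate_mset (v - r) 0" by (rule multiset_eqI)
  with U Ud BB d size rs pos dP show ?thesis by (intro that[of U d P]) auto
qed

theorem theorem1:
  fixes Q :: "real mat" and w :: "real vec" and v s r :: nat
    and \<Phi> :: "real mat \<Rightarrow> real" and \<phi> :: "real list \<Rightarrow> real" and L :: "real mat"
  assumes "pairwise_comparison_system v s Q"
    and "r = mat_rank Q"
    and "feasible_design v w"
    and "information_function s \<Phi>"
    and "orthogonally_invariant s \<Phi>"
    and "\<And>H. H \<in> nnd_mats s \<Longrightarrow> \<Phi> H = \<phi> (map (eigval H) [1..<s + 1])"
    and "L = weighted_laplacian (comparison_graph Q) (\<lambda>i. 1 / w $ i)"
  shows "(full_rank_system Q \<longrightarrow>
            criterion_value \<Phi> Q w = \<phi> (map (\<lambda>k. 1 / eigval L k) (rev [1..<s + 1]))) \<and>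
         (\<not> full_rank_system Q \<longrightarrow>
            criterion_value \<Phi> Q w =
              \<phi> (map (\<lambda>k. 1 / eigval L k) (rev [1..<r + 1]) @ replicate (s - r) 0))"
proof -
  have Q: "Q \<in> carrier_mat v s"
    using assms(1) by (simp add: pairwise_comparison_system_def contrast_system_def)
  define a where "a = (\<lambda>i. 1 / w $ i)"
  have a: "a i > 0" if "i < v" for i
    using assms(3) that by (simp add: a_def feasible_design_def)
  have r: "r = vec_space.rank v Q" using assms(2) Q by simp
  have L: "L = mat_diag v (\<lambda>i. sqrt (a i)) * Q * transpose_mat Q * mat_diag v (\<lambda>i. sqrt (a i))"
    unfolding assms(7) weighted_laplacian_def Let_def incidence_mat_comparison_graph[OF assms(1)]
    using Q by (simp add: comparison_graph_def a_def)
  obtain U d P where U: "U \<in> orthonormal_mats s"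
    and Ud: "transpose_mat Q * mat_diag v a * Q = U * mat_diag s d * transpose_mat U"
    and d: "\<And>i. i < s \<Longrightarrow> d i \<ge> 0" and P: "size P = r" "r \<le> s" "\<And>x. x \<in># P \<Longrightarrow> x > 0"
    and dP: "mset (map d [0..<s]) = P + replicate_mset (s - r) 0"
    and LP: "proots (char_poly L) = P + replicate_mset (v - r) 0"
    using weighted_gram_spectrum[where a = a, OF Q a] unfolding r L by blast
  define A where "A = transpose_mat Q * inverse_mat (moment_mat w) * Q"
  have A: "A = U * mat_diag s d * transpose_mat U"
    unfolding A_def inverse_moment_mat[OF assms(3)] using Ud by (simp add: a_def)
  \<comment> \<open>One candidate for both cases: the pseudoinverse of A in general, and its inverse
    once no d i vanishes.\<close>
  define X where "X = U * mat_diag s (\<lambda>i. inverse (d i)) * transpose_mat U"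
  have carr: "A \<in> carrier_mat s s" "X \<in> carrier_mat s s"
    using orthonormal_matsD[OF U] by (auto simp: A X_def intro!: mult_carrier_mat)
  let ?ys = "sorted_list_of_multiset P"
  have len: "length ?ys = r" using P(1) by (metis mset_sorted_list_of_multiset size_mset)
  have crit: "criterion_value \<Phi> Q w = \<Phi> X"
  proof (cases "full_rank_system Q")
    case True
    then have "r = s" using r Q by (simp add: full_rank_system_def)
    \<comment> \<open>With r = s the padding in \<open>dP\<close> is empty, so only the positive
      elements of \<open>P\<close> remain.\<close>
    then have "0 \<notin># mset (map d [0..<s])" unfolding dP using P(3) by force
    then have "d i \<noteq> 0" if "i < s" for i using that by force
    then have id: "mat_diag s (\<lambda>i. d i * inverse (d i)) = 1\<^sub>m s" "mat_diag s (\<lambda>i. inverse (d i) * d i) = 1\<^sub>m s"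
      by (auto intro!: eq_matI simp: mat_diag_def)
    have "A * X = 1\<^sub>m s" "X * A = 1\<^sub>m s"
      unfolding A X_def using orthonormal_matsD[OF U] id by (simp_all add: orthonormal_conj_mult[OF U])
    then have "inverse_mat A = X" using carr by (intro inverse_mat_eqI)
    then show ?thesis using True by (simp add: criterion_value_def information_mat_def A_def)
  next
    case False
    have "pseudoinverse A = X"
      by (rule pseudoinverse_eqI[OF carr(1)]) (use is_pseudoinverse_spectral[OF U, of d] in \<open>simp add: A X_def\<close>)
    then show ?thesis using False by (simp add: criterion_value_def generalized_information_mat_def A_def)
  qed
  have "mset (map (\<lambda>i. inverse (d i)) [0..<s]) = image_mset inverse (mset (map d [0..<s]))"
    by (simp add: image_mset.compositionality comp_def)
  also have "\<dots> = image_mset inverse P + replicate_mset (s - r) 0" unfolding dP by simp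
  finally have "proots (char_poly X) = image_mset inverse P + replicate_mset (s - r) 0"
    unfolding X_def proots_char_poly_spectral[OF U] .
  then have "eigvals_desc X = rev (sorted_list_of_multiset (image_mset inverse P)) @ replicate (s - r) 0"
    by (rule eigvals_desc_eq_positive_part) (use P(3) in auto)
  \<comment> \<open>\<open>?ys\<close> increases, so its reciprocals already decrease: the reversal
    in \<open>eigvals_desc\<close> cancels the one caused by inversion.\<close>
  then have eX: "eigvals_desc X = map inverse ?ys @ replicate (s - r) 0"
    by (simp add: sorted_list_of_multiset_image_inverse[OF P(3)])
  have eL: "eigvals_desc L = rev ?ys @ replicate (v - r) 0"
    by (rule eigvals_desc_eq_positive_part[OF LP P(3)])
  have "X \<in> nnd_mats s" unfolding X_def by (rule spectral_in_nnd_mats[OF U]) (simp add: d)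
  then have "criterion_value \<Phi> Q w = \<phi> (map (eigval X) [1..<s + 1])"
    unfolding crit by (rule assms(6))
  also have "map (eigval X) [1..<s + 1] = map inverse ?ys @ replicate (s - r) 0"
    by (subst map_eigval) (use P(2) len in \<open>simp_all add: eX\<close>)
  \<comment> \<open>The first r eigenvalues of L are \<open>rev ?ys\<close>, so reading them at
    positions r, ..., 1 returns \<open>?ys\<close>; the trailing zeros of L are never
    inverted.\<close>
  also have "map inverse ?ys = map (\<lambda>k. 1 / eigval L k) (rev [1..<r + 1])"
    by (subst map_reciprocal_eigval_rev) (use len in \<open>simp_all add: eL rev_map\<close>)
  finally have main: "criterion_value \<Phi> Q w =
      \<phi> (map (\<lambda>k. 1 / eigval L k) (rev [1..<r + 1]) @ replicate (s - r) 0)" .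
  \<comment> \<open>Then the block of s - r zeros is empty and \<open>main\<close> becomes the
    full-rank formula.\<close>
  moreover have "r = s" if "full_rank_system Q" using that r Q by (simp add: full_rank_system_def)
  ultimately show ?thesis by auto
qed

end
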